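(* Let $X$ be an absolutely continuous nonnegative random variable with PDF $f$ and CDF $F$ such that $F(t)>0$ for all $t>0$. Let $\{X_n,n\ge 1\}$ be the sequence of random variables with PDFs $f_1=f$, $f_{n+1}=T_nf_n$ and CDFs $F_1=F$, $F_{n+1}=F_n(1+T_n)$, where $T_n=-\log F_n$. Then for all $n=1,2,\ldots$, $$X_n\ge_{\rm lr}X_{n+1}.$$
   Context: The sequence is defined by $X_1\stackrel{D}{=}X$ and $[X_{n+1}\,|\,X_n=t]\stackrel{D}{=}[X_n\,|\,X_n\le t]$ for $t>0$, $n\ge1$; equivalently the CDFs and PDFs satisfy the stated recursions on $(0,\infty)$. For absolutely continuous random variables $U,V$ with supports $(l_U,u_U)$, $(l_V,u_V)$ and PDFs $f_U,f_V$, $U$ is smaller than $V$ in the likelihood ratio order ($U\le_{\rm lr}V$, also written $V\ge_{\rm lr}U$) if $f_U(x)f_V(y)\ge f_U(y)f_V(x)$ for all $x\le y$ with $x,y\in(l_U,u_U)\cup(l_V,u_V)$. *)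

theory Defs
  imports "HOL-Probability.Probability"
begin

text \<open>
  The library predicate \<open>distributed\<close> takes a density with values in \<^typ>\<open>ennreal\<close>. For a
  real-valued density, pointwise nonnegativity is required separately, because \<^const>\<open>ennreal\<close>
  truncates negative values to 0.
\<close>

definition has_pdf :: "'a measure \<Rightarrow> ('a \<Rightarrow> real) \<Rightarrow> (real \<Rightarrow> real) \<Rightarrow> bool" where
  "has_pdf M U f \<longleftrightarrow> (\<forall>x. 0 \<le> f x) \<and> distributed M lborel U (\<lambda>x. ennreal (f x))"

definition cdf_of :: "'a measure \<Rightarrow> ('a \<Rightarrow> real) \<Rightarrow> real \<Rightarrow> real" where
  "cdf_of M U = cdf (distr M borel U)"

text \<open>
  The support of \<open>U\<close> is the open interval between \<open>inf {x. F x > 0}\<close> and \<open>sup {x. F x < 1}\<close>, where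
  \<open>F\<close> is the distribution function of \<open>U\<close>; either endpoint may be infinite. The density may
  vanish inside this interval.
\<close>

definition supp_lower :: "'a measure \<Rightarrow> ('a \<Rightarrow> real) \<Rightarrow> ereal" where
  "supp_lower M U = (INF x\<in>{x. cdf_of M U x > 0}. ereal x)"

definition supp_upper :: "'a measure \<Rightarrow> ('a \<Rightarrow> real) \<Rightarrow> ereal" where
  "supp_upper M U = (SUP x\<in>{x. cdf_of M U x < 1}. ereal x)"

definition supp_interval :: "'a measure \<Rightarrow> ('a \<Rightarrow> real) \<Rightarrow> real set" where
  "supp_interval M U = einterval (supp_lower M U) (supp_upper M U)"

text \<open>
  \<open>lr_le M U f N V g\<close>: \<open>U\<close> (on \<open>M\<close>, with density \<open>f\<close>) is smaller than \<open>V\<close> (on \<open>N\<close>, with density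
  \<open>g\<close>) in the likelihood ratio order. The defining inequality is pointwise, so the chosen versions
  of the densities are arguments of the relation.
\<close>

definition lr_le ::
  "'a measure \<Rightarrow> ('a \<Rightarrow> real) \<Rightarrow> (real \<Rightarrow> real) \<Rightarrow> 'b measure \<Rightarrow> ('b \<Rightarrow> real) \<Rightarrow> (real \<Rightarrow> real) \<Rightarrow> bool"
  where
  "lr_le M U f N V g \<longleftrightarrow>
     has_pdf M U f \<and> has_pdf N V g \<and>
     (\<forall>x\<in>supp_interval M U \<union> supp_interval N V. \<forall>y\<in>supp_interval M U \<union> supp_interval N V.
        x \<le> y \<longrightarrow> f x * g y \<ge> f y * g x)"

end

theory Submission
  imports Defs "HOL-Real_Asymp.Real_Asymp"
begin

text \<open>
  On \<open>(0,\<infinity>)\<close> the ratio \<open>f\<^bsub>n+1\<^esub>/f\<^sub>n = - ln F\<^sub>n\<close> is decreasing, so only the location of the supports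
  needs an argument: \<open>F\<^sub>n\<close> vanishes at 0 for every \<open>n\<close>, because \<open>u (1 - ln u) \<rightarrow> 0\<close> as \<open>u \<rightarrow> 0+\<close>
  carries \<open>F\<^sub>n(0) = 0\<close> over to \<open>F\<^bsub>n+1\<^esub>\<close> by right continuity.
\<close>

lemma real_distribution_distr_has_pdf:
  assumes "prob_space M" "has_pdf M U g"
  shows "real_distribution (distr M borel U)"
proof -
  have "U \<in> borel_measurable M"
    using assms(2) unfolding has_pdf_def distributed_def by simp
  then show ?thesis
    using assms(1) prob_space.real_distribution_distr by blast
qed

text \<open>A law with a density has no atom at 0, so a variable that is almost surely nonnegative
  is almost surely positive.\<close>

lemma cdf_of_zero:
  assumes "prob_space M" "has_pdf M U g" "AE \<omega> in M. 0 \<le> U \<omega>"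
  shows "cdf_of M U 0 = 0"
proof -
  interpret prob_space M by fact
  have D: "distributed M lborel U (\<lambda>x. ennreal (g x))"
    using assms(2) by (simp add: has_pdf_def)
  then have U [measurable]: "U \<in> borel_measurable M"
    by (simp add: distributed_def)
  have "AE x in lborel. x \<noteq> (0::real)"
    by (rule AE_lborel_singleton)
  then have "AE x in density lborel (\<lambda>x. ennreal (g x)). x \<noteq> 0"
    using D by (subst AE_density) (auto simp: distributed_def)
  then have "AE x in distr M lborel U. x \<noteq> 0"
    unfolding distributed_distr_eq_density[OF D] .
  then have "AE \<omega> in M. U \<omega> \<noteq> 0"
    by (subst (asm) AE_distr_iff) auto
  with assms(3) have "AE \<omega> in M. \<not> U \<omega> \<le> 0"
    by eventually_elim auto
  then have "prob (U -` {..0} \<inter> space M) = 0"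
    by (subst prob_eq_0) auto
  then show ?thesis
    by (simp add: cdf_of_def cdf_def measure_distr)
qed

text \<open>Needed because the recursions are available only at positive arguments. Monotonicity of
  the CDF bounds \<open>supp_lower\<close> below by 0, and openness of the interval makes the
  inequality strict.\<close>

lemma supp_interval_pos:
  assumes "prob_space M" "has_pdf M U g" "cdf_of M U 0 = 0" "x \<in> supp_interval M U"
  shows "0 < x"
proof -
  interpret real_distribution "distr M borel U"
    using assms(1,2) by (rule real_distribution_distr_has_pdf)
  have "0 < z" if "0 < cdf_of M U z" for z
    using that assms(3) cdf_nondecreasing[of z 0] by (force simp: cdf_of_def)
  then have "0 \<le> supp_lower M U"
    unfolding supp_lower_def by (intro INF_greatest) (simp add: less_imp_le)
  also have "\<dots> < ereal x"
    using assms(4) by (simp add: supp_interval_def einterval_def)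
  finally show ?thesis by simp
qed

lemma mult_one_minus_ln_tendsto_zero:
  "((\<lambda>u::real. u * (1 - ln u)) \<longlongrightarrow> 0) (at_right 0)"
  by real_asymp

theorem theorem3:
  fixes P :: "'a measure" and X :: "'a \<Rightarrow> real" and f F :: "real \<Rightarrow> real"
    and M :: "'b measure" and Xs :: "nat \<Rightarrow> 'b \<Rightarrow> real"
    and fs Fs T :: "nat \<Rightarrow> real \<Rightarrow> real"
  assumes "prob_space P"
    and "has_pdf P X f"
    and "F = cdf_of P X"
    and "AE \<omega> in P. 0 \<le> X \<omega>"
    and "\<And>t. t > 0 \<Longrightarrow> F t > 0"
    and "prob_space M"
    and "\<And>n. n \<ge> 1 \<Longrightarrow> has_pdf M (Xs n) (fs n)"
    and "\<And>n. n \<ge> 1 \<Longrightarrow> cdf_of M (Xs n) = Fs n"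
    and "\<And>n t. n \<ge> 1 \<Longrightarrow> t > 0 \<Longrightarrow> T n t = - ln (Fs n t)"
    and "fs 1 = f"
    and "\<And>n t. n \<ge> 1 \<Longrightarrow> t > 0 \<Longrightarrow> fs (n + 1) t = T n t * fs n t"
    and "Fs 1 = F"
    and "\<And>n t. n \<ge> 1 \<Longrightarrow> t > 0 \<Longrightarrow> Fs (n + 1) t = Fs n t * (1 + T n t)"
  shows "\<forall>n\<ge>1. lr_le M (Xs (n + 1)) (fs (n + 1)) M (Xs n) (fs n)"
proof (intro allI impI)
  note P = assms(1) and f_pdf = assms(2) and F = assms(3) and X_nonneg = assms(4) and F_pos = assms(5)
    and M = assms(6) and pdf = assms(7) and cdf = assms(8) and T = assms(9)
    and f_Suc = assms(11) and F_1 = assms(12) and F_Suc = assms(13)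
  have distr: "real_distribution (distr M borel (Xs n))" if "n \<ge> 1" for n
    using M pdf[OF that] by (rule real_distribution_distr_has_pdf)
  have Fs: "Fs n = Distribution_Functions.cdf (distr M borel (Xs n))" if "n \<ge> 1" for n
    using cdf[OF that] by (simp add: cdf_of_def)
  have Fs_le_1: "Fs n t \<le> 1" if "n \<ge> 1" for n t
    unfolding Fs[OF that] by (rule real_distribution.cdf_bounded_prob[OF distr[OF that]])
  have Fs_mono: "Fs n s \<le> Fs n t" if "n \<ge> 1" "s \<le> t" for n s t
    unfolding Fs[OF that(1)]
    by (rule finite_borel_measure.cdf_nondecreasing[OF _ that(2)])
      (rule real_distribution.finite_borel_measure_M[OF distr[OF that(1)]])
  have Fs_right: "(Fs n \<longlongrightarrow> Fs n 0) (at_right 0)" if "n \<ge> 1" for n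
    using finite_borel_measure.cdf_is_right_cont
      [OF real_distribution.finite_borel_measure_M[OF distr[OF that]], of 0]
    unfolding Fs[OF that] continuous_within .
  have Fs_pos: "Fs n t > 0" if "n \<ge> 1" "t > 0" for n t
    using that(1)
  proof (induction rule: dec_induct)
    case base
    show ?case using F_1 F_pos[OF that(2)] by simp
  next
    case (step n)
    \<comment> \<open>Since 0 < \<open>Fs n t\<close> \<le> 1, its logarithm is at most 0, so the
      factor 1 + \<open>T n t\<close> is at least 1.\<close>
    have "0 < 1 - ln (Fs n t)"
      using Fs_le_1[OF step.hyps(1), of t] ln_le_zero_iff[OF step.IH] by linarith
    then show ?case
      using step F_Suc[of n t] T[of n t] that(2) by simp
  qed
  have Fs_0: "Fs n 0 = 0" if "n \<ge> 1" for n
    using that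
  proof (induction rule: dec_induct)
    case base
    \<comment> \<open>Nonnegativity is assumed only for \<open>X\<close> on \<open>P\<close>; it
      reaches \<open>Xs 1\<close> on \<open>M\<close> through the common CDF.\<close>
    show ?case using F_1 F cdf_of_zero[OF P f_pdf X_nonneg] by simp
  next
    case (step n)
    \<comment> \<open>Convergence to 0 alone is too weak: the limit of u (1 - ln u) is one-sided, so
      \<open>Fs n\<close> must approach 0 through positive values.\<close>
    have "filterlim (Fs n) (at_right 0) (at_right 0)"
      using Fs_right[OF step.hyps(1)] Fs_pos[OF step.hyps(1)] step.IH
      by (force simp: filterlim_at intro!: eventually_at_rightI[of 0 1])
    then have "((\<lambda>t. Fs n t * (1 - ln (Fs n t))) \<longlongrightarrow> 0) (at_right 0)"
      by (rule filterlim_compose[OF mult_one_minus_ln_tendsto_zero])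
    \<comment> \<open>The recursion says nothing at t = 0 itself, so it is used along t > 0 and the
      value at 0 is recovered as the right limit.\<close>
    moreover have "\<forall>\<^sub>F t in at_right 0. Fs n t * (1 - ln (Fs n t)) = Fs (Suc n) t"
      using F_Suc[OF step.hyps(1)] T[OF step.hyps(1)] by (auto intro!: eventually_at_rightI[of 0 1])
    ultimately have "(Fs (Suc n) \<longlongrightarrow> 0) (at_right 0)"
      by (rule Lim_transform_eventually)
    then show ?case
      using tendsto_unique[OF trivial_limit_at_right_real Fs_right[of "Suc n"]] by simp
  qed
  have supp: "0 < x" if "n \<ge> 1" "x \<in> supp_interval M (Xs n)" for n x
    using supp_interval_pos[OF M pdf[OF that(1)] _ that(2)] Fs_0[OF that(1)] cdf[OF that(1)] by simp
  fix n :: nat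
  assume n: "1 \<le> n"
  have "fs (n + 1) y * fs n x \<le> fs (n + 1) x * fs n y" if "0 < x" "x \<le> y" for x y
  proof -
    have "T n y \<le> T n x"
      using Fs_mono[OF n that(2)] Fs_pos[OF n that(1)] that T[OF n] by simp
    \<comment> \<open>Multiplying by the common nonnegative factor instead of dividing densities
      allows them to vanish inside the support.\<close>
    then have "T n y * (fs n x * fs n y) \<le> T n x * (fs n x * fs n y)"
      using pdf[OF n] by (intro mult_right_mono mult_nonneg_nonneg) (auto simp: has_pdf_def)
    then show ?thesis
      using f_Suc[OF n] that by (simp add: mult_ac)
  qed
  then show "lr_le M (Xs (n + 1)) (fs (n + 1)) M (Xs n) (fs n)"
    using pdf[of "n + 1"] pdf[OF n] supp[of "n + 1"] supp[OF n] by (auto simp: lr_le_def)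
qed

end
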